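(* Let $n\ge 2$ be a fixed integer. Then, as $k\to\infty$, $$s_k^{\mathtt{HC}}(n)=2^{1/k}\sqrt{k}\,(1+o_k(1)).$$
   Context: $|x-y|$ denotes Euclidean distance. A Hamiltonian cycle $H$ through an $n$-element set $X$, $n\ge 2$, is a cyclic ordering $x_1,\ldots,x_n$ of all points of $X$, with edges $x_ix_{i+1}$, $i=1,\ldots,n$, where $x_{n+1}:=x_1$ (so for $n=2$ the single segment is counted twice). Let $s_k(H)=\left(\sum_{i=1}^n|x_i-x_{i+1}|^k\right)^{1/k}$. For finite $X\subseteq[0,1]^k$, $s_k^{\mathtt{HC}}(X)$ is the minimum of $s_k(H)$ over all Hamiltonian cycles $H$ through $X$, and $s_k^{\mathtt{HC}}(n)=\sup\{s_k^{\mathtt{HC}}(X):X\subseteq[0,1]^k,\ |X|=n\}$. The notation $o_k(1)$ denotes a quantity tending to $0$ as $k\to\infty$ (with $n$ held fixed). *)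

theory Defs
  imports "HOL-Analysis.Analysis" "HOL-Combinatorics.Multiset_Permutations"
begin

text \<open>
  The dimension k varies inside the theorem, so points of k-dimensional Euclidean space are
  functions on nat that are \<^const>\<open>undefined\<close> outside the index set \<open>{..<k}\<close>
  (which makes equality of points coincide with equality of the k coordinates).
\<close>

definition unit_cube :: "nat \<Rightarrow> (nat \<Rightarrow> real) set" where
  "unit_cube k = (\<Pi>\<^sub>E i\<in>{..<k}. {0..1})"

definition euclid_dist :: "nat \<Rightarrow> (nat \<Rightarrow> real) \<Rightarrow> (nat \<Rightarrow> real) \<Rightarrow> real" where
  "euclid_dist k x y = L2_set (\<lambda>i. x i - y i) {..<k}"

text \<open>
  A Hamiltonian cycle through X is represented by an element of \<^term>\<open>permutations_of_set X\<close>, i.e.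
  a distinct list with set X, read cyclically. Different lists may represent the same cycle,
  which does not affect the minimum below. For two points the single segment is
  counted twice.
\<close>

definition cycle_s :: "nat \<Rightarrow> (nat \<Rightarrow> real) list \<Rightarrow> real" where
  "cycle_s k xs =
     (\<Sum>i<length xs. euclid_dist k (xs ! i) (xs ! (Suc i mod length xs)) ^ k) powr (1 / real k)"

definition sHC_set :: "nat \<Rightarrow> (nat \<Rightarrow> real) set \<Rightarrow> real" where
  "sHC_set k X = Min (cycle_s k ` permutations_of_set X)"

text \<open>
  For \<open>k \<ge> 1\<close> the supremum is over a nonempty set that is bounded above (all distances in the
  unit cube are at most \<open>sqrt k\<close>), so it is the genuine supremum.
\<close>

definition sHC :: "nat \<Rightarrow> nat \<Rightarrow> real" where
  "sHC k n = (SUP X\<in>{X. X \<subseteq> unit_cube k \<and> finite X \<and> card X = n}. sHC_set k X)"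

end

theory Submission
  imports Defs "HOL-Real_Asymp.Real_Asymp"
begin

text \<open>
  Only \<open>s / sqrt k \<longlonglongrightarrow> 1\<close> matters, since \<open>c powr (1 / k) \<longlonglongrightarrow> 1\<close> for every fixed \<open>c > 0\<close>.
  From above, each of the n edges has length at most \<open>sqrt k\<close>, so \<open>s \<le> n powr (1 / k) * sqrt k\<close>.
  From below, put one point at the corner \<open>(1, \<dots>, 1)\<close> and the remaining \<open>n - 1\<close> points on the
  first coordinate axis: every cycle has an edge at that corner, and its length is at least
  \<open>sqrt (k - 1)\<close>.
\<close>

lemma euclid_dist_nonneg: "0 \<le> euclid_dist k x y"
  by (simp add: euclid_dist_def L2_set_nonneg)

lemma euclid_dist_le_sqrt:
  assumes "x \<in> unit_cube k" "y \<in> unit_cube k"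
  shows "euclid_dist k x y \<le> sqrt (real k)"
proof -
  have "(x i - y i)\<^sup>2 \<le> 1" if "i < k" for i
  proof -
    have "x i \<in> {0..1}" "y i \<in> {0..1}"
      using assms that by (auto simp: unit_cube_def PiE_iff)
    hence "\<bar>x i - y i\<bar> \<le> 1" by auto
    thus ?thesis by (simp add: abs_square_le_1)
  qed
  hence "(\<Sum>i<k. (x i - y i)\<^sup>2) \<le> (\<Sum>i<k. 1)"
    by (intro sum_mono) auto
  thus ?thesis by (simp add: euclid_dist_def L2_set_def)
qed

lemma cycle_s_le:
  assumes "k \<ge> 1" "set xs \<subseteq> unit_cube k"
  shows "cycle_s k xs \<le> real (length xs) powr (1 / real k) * sqrt (real k)"
proof -
  have "(\<Sum>i<length xs. euclid_dist k (xs ! i) (xs ! (Suc i mod length xs)) ^ k)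
          \<le> (\<Sum>i<length xs. sqrt (real k) ^ k)"
  proof (intro sum_mono power_mono euclid_dist_le_sqrt euclid_dist_nonneg)
    fix i assume "i \<in> {..<length xs}"
    thus "xs ! i \<in> unit_cube k" "xs ! (Suc i mod length xs) \<in> unit_cube k"
      using assms(2) by (auto intro!: subsetD[OF assms(2)] nth_mem mod_less_divisor)
  qed
  hence "cycle_s k xs \<le> (real (length xs) * sqrt (real k) ^ k) powr (1 / real k)"
    unfolding cycle_s_def
    by (intro powr_mono2) (auto intro!: sum_nonneg zero_le_power euclid_dist_nonneg)
  \<comment> \<open>For \<open>k \<ge> 1\<close> the base \<open>sqrt (real k)\<close> is positive
    and the exponents \<open>k\<close> and \<open>1 / k\<close> cancel, so only the number of edges
    keeps a root.\<close>
  also have "\<dots> = real (length xs) powr (1 / real k) * sqrt (real k)"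
    using assms(1) by (simp add: powr_mult powr_realpow[symmetric] powr_powr)
  finally show ?thesis .
qed

lemma edge_le_cycle_s:
  assumes "k \<ge> 1" "i < length xs"
  shows "euclid_dist k (xs ! i) (xs ! (Suc i mod length xs)) \<le> cycle_s k xs"
proof -
  define d where "d i = euclid_dist k (xs ! i) (xs ! (Suc i mod length xs))" for i
  have d0: "d j \<ge> 0" for j by (simp add: d_def euclid_dist_nonneg)
  have "d i ^ k \<le> (\<Sum>i<length xs. d i ^ k)"
    using assms(2) d0 by (intro member_le_sum) auto
  hence "(d i ^ k) powr (1 / real k) \<le> cycle_s k xs"
    unfolding cycle_s_def d_def[symmetric] using d0 by (intro powr_mono2) auto
  \<comment> \<open>Rewriting the power as \<open>powr\<close> requires a positive base, so an edge
    of length 0 is treated separately; there \<open>k \<ge> 1\<close> gives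
    \<open>0 ^ k = 0\<close>.\<close>
  moreover have "(d i ^ k) powr (1 / real k) = d i"
    using assms(1) d0[of i]
    by (cases "d i = 0") (auto simp: powr_realpow[symmetric] powr_powr)
  ultimately show ?thesis by (simp add: d_def)
qed

lemma sHC_set_le:
  assumes "k \<ge> 1" "X \<subseteq> unit_cube k" "finite X"
  shows "sHC_set k X \<le> real (card X) powr (1 / real k) * sqrt (real k)"
proof -
  obtain xs where xs: "xs \<in> permutations_of_set X"
    using assms(3) permutations_of_set_empty_iff by blast
  have "sHC_set k X \<le> cycle_s k xs"
    unfolding sHC_set_def using xs by (intro Min_le) auto
  also have "\<dots> \<le> real (length xs) powr (1 / real k) * sqrt (real k)"
    using xs assms by (intro cycle_s_le) (auto dest: permutations_of_setD)
  finally show ?thesis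
    using xs by (simp add: length_finite_permutations_of_set)
qed

text \<open>In every cyclic ordering the successor of \<open>p\<close> is another point of
  \<open>X\<close>, so one edge alone already has length at least \<open>c\<close>. Ignoring the
  second edge at \<open>p\<close> gives up a factor \<open>2 powr (1 / k)\<close>, which tends to
  1.\<close>

lemma sHC_set_ge:
  assumes "k \<ge> 1" "finite X" "p \<in> X" "card X \<ge> 2"
    and far: "\<And>q. q \<in> X \<Longrightarrow> q \<noteq> p \<Longrightarrow> c \<le> euclid_dist k p q"
  shows "c \<le> sHC_set k X"
proof -
  have "c \<le> cycle_s k xs" if xs: "xs \<in> permutations_of_set X" for xs
  proof -
    have X: "set xs = X" "distinct xs" using xs by (auto dest: permutations_of_setD)
    hence len: "length xs \<ge> 2" using assms(4) distinct_card by fastforce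
    obtain i where i: "i < length xs" "xs ! i = p"
      using assms(3) X by (auto simp: in_set_conv_nth)
    let ?j = "Suc i mod length xs"
    \<comment> \<open>With at least two entries the cyclic successor of an index is a different
      index, also at the wrap-around; distinctness of \<open>xs\<close> then makes it a different
      point.\<close>
    have j: "?j < length xs" "?j \<noteq> i"
      using len i(1) by (auto simp: mod_Suc)
    hence "xs ! ?j \<noteq> p" "xs ! ?j \<in> X"
      using i X by (auto simp: nth_eq_iff_index_eq)
    hence "c \<le> euclid_dist k (xs ! i) (xs ! ?j)"
      using far i by auto
    also have "\<dots> \<le> cycle_s k xs"
      using assms(1) i by (intro edge_le_cycle_s)
    finally show ?thesis .
  qed
  thus ?thesis
    unfolding sHC_set_def using assms(2) by (subst Min_ge_iff) auto
qed

lemma exists_far_configuration: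
  assumes "n \<ge> 2" "k \<ge> 1"
  obtains X where "X \<subseteq> unit_cube k" "finite X" "card X = n" "sqrt (real k - 1) \<le> sHC_set k X"
proof -
  define p :: "nat \<Rightarrow> real" where "p = (\<lambda>i\<in>{..<k}. 1)"
  \<comment> \<open>The first coordinate \<open>j / n\<close> separates the points
    \<open>a j\<close> from each other, and from \<open>p\<close> since it stays below 1 for
    \<open>j < n - 1\<close>.\<close>
  define a :: "nat \<Rightarrow> nat \<Rightarrow> real"
    where "a j = (\<lambda>i\<in>{..<k}. if i = 0 then real j / real n else 0)" for j
  define X where "X = insert p (a ` {..<n - 1})"
  have a0: "a j 0 = real j / real n" for j using assms by (simp add: a_def)
  have "inj a"
  proof (rule injI)
    fix i j assume "a i = a j"
    hence "a i 0 = a j 0" by simp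
    thus "i = j" using assms(1) by (simp add: a0)
  qed
  moreover have "p \<notin> a ` {..<n - 1}"
  proof
    assume "p \<in> a ` {..<n - 1}"
    then obtain j where "j < n - 1" "p = a j" by auto
    moreover have "p 0 = 1" using assms by (simp add: p_def)
    ultimately show False using assms(1) a0[of j] by auto
  qed
  ultimately have card: "card X = n"
    using assms(1) by (simp add: X_def card_image inj_on_subset)
  have cube: "X \<subseteq> unit_cube k"
    by (auto simp: X_def unit_cube_def p_def a_def split: if_splits)
  have far: "sqrt (real k - 1) \<le> euclid_dist k p q" if q: "q \<in> X" "q \<noteq> p" for q
  proof -
    obtain j where qj: "q = a j" using q by (auto simp: X_def)
    \<comment> \<open>Coordinate 0 is discarded; each of the other \<open>k - 1\<close> coordinates
      is 1 at \<open>p\<close> and 0 at \<open>q\<close>.\<close>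
    have "real k - 1 = (\<Sum>i\<in>{..<k} - {0}. (p i - q i)\<^sup>2)"
      using assms(2) by (simp add: qj p_def a_def of_nat_diff)
    also have "\<dots> \<le> (\<Sum>i<k. (p i - q i)\<^sup>2)"
      by (intro sum_mono2) auto
    finally show ?thesis by (simp add: euclid_dist_def L2_set_def)
  qed
  have "finite X" "p \<in> X" by (simp_all add: X_def)
  with cube card far assms show thesis
    by (intro that[of X] sHC_set_ge[of k X p]) auto
qed

lemma sHC_bounds:
  assumes "n \<ge> 2" "k \<ge> 1"
  shows "sqrt (real k - 1) \<le> sHC k n" "sHC k n \<le> real n powr (1 / real k) * sqrt (real k)"
proof -
  \<comment> \<open>The configuration serves twice: it makes the family nonempty, so that the upper
    bound passes to the supremum, and it supplies the lower bound.\<close>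
  obtain X where X: "X \<subseteq> unit_cube k" "finite X" "card X = n" "sqrt (real k - 1) \<le> sHC_set k X"
    using exists_far_configuration assms by blast
  let ?F = "{X. X \<subseteq> unit_cube k \<and> finite X \<and> card X = n}"
  have le: "sHC_set k Y \<le> real n powr (1 / real k) * sqrt (real k)" if "Y \<in> ?F" for Y
    using sHC_set_le[of k Y] assms(2) that by auto
  show "sHC k n \<le> real n powr (1 / real k) * sqrt (real k)"
    unfolding sHC_def using X le by (intro cSUP_least) auto
  have "bdd_above (sHC_set k ` ?F)"
    using le by (intro bdd_aboveI2)
  hence "sHC_set k X \<le> sHC k n"
    unfolding sHC_def using X by (intro cSUP_upper) auto
  with X(4) show "sqrt (real k - 1) \<le> sHC k n" by linarith
qed

theorem theorem1p7:
  fixes n :: nat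
  assumes "n \<ge> 2"
  shows "\<exists>\<epsilon> :: nat \<Rightarrow> real. \<epsilon> \<longlonglongrightarrow> 0 \<and>
           (\<forall>k\<ge>1. sHC k n = 2 powr (1 / real k) * sqrt (real k) * (1 + \<epsilon> k))"
proof -
  \<comment> \<open>The error term will be \<open>r k - 1\<close>. At \<open>k = 0\<close> the
    divisor vanishes and \<open>r 0 = 0\<close>, which is harmless because the identity is claimed
    for \<open>k \<ge> 1\<close>.\<close>
  define r where "r k = sHC k n / (2 powr (1 / real k) * sqrt (real k))" for k
  have "real n > 0" using assms by simp
  have "r \<longlonglongrightarrow> 1"
  proof (rule tendsto_sandwich)
    show "\<forall>\<^sub>F k in sequentially. sqrt (real k - 1) / (2 powr (1 / real k) * sqrt (real k)) \<le> r k"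
      using eventually_ge_at_top[of 1]
      by eventually_elim (auto simp: r_def intro!: divide_right_mono sHC_bounds assms)
    show "\<forall>\<^sub>F k in sequentially. r k \<le>
            real n powr (1 / real k) * sqrt (real k) / (2 powr (1 / real k) * sqrt (real k))"
      using eventually_ge_at_top[of 1]
      by eventually_elim (unfold r_def, intro divide_right_mono sHC_bounds assms, auto)
    show "(\<lambda>k. sqrt (real k - 1) / (2 powr (1 / real k) * sqrt (real k))) \<longlonglongrightarrow> 1"
      by real_asymp
    \<comment> \<open>For \<open>k \<ge> 1\<close> this quotient equals
      \<open>(n / 2) powr (1 / k)\<close>.\<close>
    show "(\<lambda>k. real n powr (1 / real k) * sqrt (real k) / (2 powr (1 / real k) * sqrt (real k)))
            \<longlonglongrightarrow> 1"
      using \<open>real n > 0\<close> by real_asymp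
  qed
  hence "(\<lambda>k. r k - 1) \<longlonglongrightarrow> 0"
    by (simp add: LIM_zero)
  moreover have "\<forall>k\<ge>1. sHC k n = 2 powr (1 / real k) * sqrt (real k) * (1 + (r k - 1))"
    by (simp add: r_def)
  ultimately show ?thesis by blast
qed

end
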